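(* Let $\theta=e^{\pi i/6}$ and let $$A=\begin{pmatrix}0&0&0&0&0&0\\0&0&3&6&6&9\\0&3&9&1&7&6\\0&6&4&10&1&7\\0&6&10&7&4&1\\0&9&6&4&10&3\end{pmatrix}$$ with entries in $\mathbb{Z}/12\mathbb{Z}$ and rows and columns indexed by $0,\dots,5$. Let $H$ be the $6\times6$ complex matrix with entries $H_{rs}=\theta^{A_{rs}}$. Let $P$ be the $6\times6$ permutation matrix whose left multiplication exchanges rows $4$ and $5$ and fixes rows $0,1,2,3$, and set $K=PH^{\mathsf T}$; equivalently, $K_{rs}=\theta^{B_{rs}}$ with $$B=\begin{pmatrix}0&0&0&0&0&0\\0&0&3&6&6&9\\0&3&9&4&10&6\\0&6&1&10&7&4\\0&9&6&7&1&3\\0&6&7&1&4&10\end{pmatrix}.$$ Let $h_0,\dots,h_5$ and $k_0,\dots,k_5$ be the columns of $H$ and $K$, respectively, and let $\Phi_{35}$ be the $6\times 6$ array of vectors with $(i,j)$ entry $\frac{1}{\sqrt6}(h_i\odot k_j)\in\mathbb{C}^6$, $0\le i,j\le5$. Then $\Phi_{35}$ is a quantum Latin square of order $6$ and its cardinality is $35$.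
   Context: For $x,y\in\mathbb{C}^n$, $x\odot y=(x_0y_0,\dots,x_{n-1}y_{n-1})^{\mathsf T}$ is the entrywise (Schur) product. A quantum Latin square of order $n$, denoted $\mathrm{QLS}(n)$, is an $n\times n$ array $(\phi_{ij})_{0\le i,j\le n-1}$ of unit vectors in $\mathbb{C}^n$ such that every row and every column forms an orthonormal basis of $\mathbb{C}^n$. Two unit vectors $u,v$ are phase equivalent, $u\sim v$, if $u=e^{i\alpha}v$ for some $\alpha\in\mathbb{R}$. The cardinality of a quantum Latin square is the number of distinct phase-equivalence classes among its $n^2$ entries. *)

theory Defs
  imports
    Complex_Main
    "Jordan_Normal_Form.Gauss_Jordan_Elimination"
    "Jordan_Normal_Form.Gram_Schmidt"
begin

definition schur_product :: "complex vec \<Rightarrow> complex vec \<Rightarrow> complex vec" (infixl "\<odot>" 70) where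
  "x \<odot> y = vec (dim_vec x) (\<lambda>r. x $ r * y $ r)"

definition unit_vectors :: "nat \<Rightarrow> complex vec set" where
  "unit_vectors n = {v \<in> carrier_vec n. v \<bullet>c v = 1}"

(* The family b 0, ..., b (n-1) is an orthonormal basis of C^n. *)
definition orthonormal_basis :: "nat \<Rightarrow> (nat \<Rightarrow> complex vec) \<Rightarrow> bool" where
  "orthonormal_basis n b \<longleftrightarrow>
     (\<forall>i<n. b i \<in> unit_vectors n) \<and>
     (\<forall>i<n. \<forall>j<n. i \<noteq> j \<longrightarrow> b i \<bullet>c b j = 0) \<and>
     vectorspace.basis class_ring (module_vec TYPE(complex) n) (b ` {..<n})"

(* An n x n array of vectors is a function of two indices; only indices below n matter. *)
definition quantum_latin_square :: "nat \<Rightarrow> (nat \<Rightarrow> nat \<Rightarrow> complex vec) \<Rightarrow> bool" where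
  "quantum_latin_square n \<phi> \<longleftrightarrow>
     (\<forall>i<n. \<forall>j<n. \<phi> i j \<in> unit_vectors n) \<and>
     (\<forall>i<n. orthonormal_basis n (\<lambda>j. \<phi> i j)) \<and>
     (\<forall>j<n. orthonormal_basis n (\<lambda>i. \<phi> i j))"

definition phase_equivalence :: "nat \<Rightarrow> (complex vec \<times> complex vec) set" where
  "phase_equivalence n =
     {(u, v). u \<in> unit_vectors n \<and> v \<in> unit_vectors n \<and>
              (\<exists>\<alpha>::real. u = exp (\<i> * of_real \<alpha>) \<cdot>\<^sub>v v)}"

lemma equiv_phase_equivalence: "equiv (unit_vectors n) (phase_equivalence n)"
proof (rule equivI)
  show "phase_equivalence n \<subseteq> unit_vectors n \<times> unit_vectors n"
    by (auto simp: phase_equivalence_def)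
  show "refl_on (unit_vectors n) (phase_equivalence n)"
    by (auto simp: refl_on_def phase_equivalence_def intro!: exI[of _ 0])
  show "sym (phase_equivalence n)"
  proof (rule symI)
    fix u v assume "(u, v) \<in> phase_equivalence n"
    then obtain \<alpha> where *: "u \<in> unit_vectors n" "v \<in> unit_vectors n"
      "u = exp (\<i> * of_real \<alpha>) \<cdot>\<^sub>v v"
      by (auto simp: phase_equivalence_def)
    have "v = exp (\<i> * of_real (- \<alpha>)) \<cdot>\<^sub>v u"
      unfolding *(3) smult_smult_assoc by (simp flip: exp_add)
    with * show "(v, u) \<in> phase_equivalence n"
      unfolding phase_equivalence_def by blast
  qed
  show "trans (phase_equivalence n)"
  proof (rule transI)
    fix u v w assume "(u, v) \<in> phase_equivalence n" "(v, w) \<in> phase_equivalence n"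
    then obtain \<alpha> \<beta> where *: "u \<in> unit_vectors n" "w \<in> unit_vectors n"
      "u = exp (\<i> * of_real \<alpha>) \<cdot>\<^sub>v v" "v = exp (\<i> * of_real \<beta>) \<cdot>\<^sub>v w"
      by (auto simp: phase_equivalence_def)
    have "u = exp (\<i> * of_real (\<alpha> + \<beta>)) \<cdot>\<^sub>v w"
      unfolding *(3,4) smult_smult_assoc by (simp add: exp_add distrib_left)
    with * show "(u, w) \<in> phase_equivalence n"
      unfolding phase_equivalence_def by blast
  qed
qed

definition qls_cardinality :: "nat \<Rightarrow> (nat \<Rightarrow> nat \<Rightarrow> complex vec) \<Rightarrow> nat" where
  "qls_cardinality n \<phi> = card ({\<phi> i j | i j. i < n \<and> j < n} // phase_equivalence n)"

definition theta :: complex where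
  "theta = exp (of_real pi * \<i> / 6)"

(* Exponents of theta live in Z/12Z; they are represented by natural numbers below 12,
   and the next lemma says that the choice of representatives does not matter. *)
lemma theta_power_mod_12: "theta ^ (a mod 12) = theta ^ a"
proof -
  have "theta ^ 12 = exp (of_nat 12 * (of_real pi * \<i> / 6))"
    unfolding theta_def by (rule exp_of_nat_mult [symmetric])
  also have "of_nat 12 * (of_real pi * \<i> / 6) = 2 * of_real pi * \<i>"
    by simp
  finally have "theta ^ 12 = 1"
    by (simp only: exp_two_pi_i)
  hence "theta ^ (12 * (a div 12) + a mod 12) = theta ^ (a mod 12)"
    by (simp only: power_add power_mult) simp
  thus ?thesis by simp
qed

definition A_exp :: "nat mat" where
  "A_exp = mat_of_rows_list 6
     [[0, 0, 0, 0, 0, 0],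
      [0, 0, 3, 6, 6, 9],
      [0, 3, 9, 1, 7, 6],
      [0, 6, 4, 10, 1, 7],
      [0, 6, 10, 7, 4, 1],
      [0, 9, 6, 4, 10, 3]]"

definition B_exp :: "nat mat" where
  "B_exp = mat_of_rows_list 6
     [[0, 0, 0, 0, 0, 0],
      [0, 0, 3, 6, 6, 9],
      [0, 3, 9, 4, 10, 6],
      [0, 6, 1, 10, 7, 4],
      [0, 9, 6, 7, 1, 3],
      [0, 6, 7, 1, 4, 10]]"

definition H_mat :: "complex mat" where
  "H_mat = map_mat (\<lambda>a. theta ^ a) A_exp"

definition P_mat :: "complex mat" where
  "P_mat = swaprows_mat 6 4 5"

definition K_mat :: "complex mat" where
  "K_mat = P_mat * H_mat\<^sup>T"

definition Phi35 :: "nat \<Rightarrow> nat \<Rightarrow> complex vec" where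
  "Phi35 i j = complex_of_real (1 / sqrt 6) \<cdot>\<^sub>v (col H_mat i \<odot> col K_mat j)"

end

theory Submission
  imports Defs
begin

text \<open>
  Multiplication by a vector of unimodular entries is unitary, so the rows and columns of
  the array inherit orthogonality from the columns of \<open>K\<close> and \<open>H\<close>, which are complex
  Hadamard matrices: every inner product of columns is a sum of twelfth roots of unity that
  reduces to \<open>0\<close> modulo the cyclotomic relation \<open>\<theta>\<^sup>4 = \<theta>\<^sup>2 - 1\<close>. Since the first
  coordinate of every entry is \<open>1 / sqrt 6\<close>, phase equivalent entries are equal, and the
  cardinality is the number of distinct exponent vectors modulo \<open>12\<close>.
\<close>

section \<open>Orthonormal bases\<close>

text \<open>Pairing a vanishing combination with \<open>b i\<close> isolates its \<open>i\<close>-th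
  coefficient, so orthonormality gives independence; \<open>n\<close> independent vectors in
  dimension \<open>n\<close> form a basis.\<close>

lemma orthonormal_basisI:
  assumes carrier: "\<And>i. i < n \<Longrightarrow> b i \<in> carrier_vec n"
    and ip: "\<And>i j. i < n \<Longrightarrow> j < n \<Longrightarrow> b i \<bullet>c b j = of_bool (i = j)"
  shows "orthonormal_basis n b"
proof -
  interpret vec_space "TYPE(complex)" n .
  let ?B = "b ` {..<n}"
  have B: "?B \<subseteq> carrier_vec n"
    using carrier by auto
  have inj: "inj_on b {..<n}"
  proof (rule inj_onI)
    fix i j assume "i \<in> {..<n}" "j \<in> {..<n}" "b i = b j"
    then show "i = j"
      using ip[of i i] ip[of i j] by (auto split: if_splits)
  qed
  have "lin_indpt ?B"
  proof (rule finite_lin_indpt2)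
    fix a assume zero: "lincomb a ?B = 0\<^sub>v n"
    show "\<forall>v\<in>?B. a v = 0"
    proof
      fix v assume "v \<in> ?B"
      then obtain i where i: "i < n" "v = b i"
        by auto
      have bi: "b i \<in> carrier_vec n" "conjugate (b i) \<in> carrier_vec n"
        using carrier[OF i(1)] by auto
      have "0 = lincomb a ?B \<bullet>c b i"
        unfolding zero using bi by simp
      also have "\<dots> = (\<Sum>u\<in>?B. (a u \<cdot>\<^sub>v u) \<bullet>c b i)"
        unfolding lincomb_def by (rule finsum_scalar_prod_sum) (use B bi in auto)
      also have "\<dots> = (\<Sum>u\<in>?B. a u * (u \<bullet>c b i))"
        by (rule sum.cong) (use B bi in auto)
      also have "\<dots> = (\<Sum>j<n. a (b j) * (b j \<bullet>c b i))"
        by (simp add: sum.reindex[OF inj])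
      also have "\<dots> = (\<Sum>j<n. if j = i then a (b j) else 0)"
        by (rule sum.cong) (auto simp: ip i)
      also have "\<dots> = a v"
        using i by simp
      finally show "a v = 0"
        by simp
    qed
  qed (use B in auto)
  then have "basis ?B"
    using B by (intro dim_li_is_basis) (simp_all add: dim_is_n card_image[OF inj])
  then show ?thesis
    using assms unfolding orthonormal_basis_def unit_vectors_def by auto
qed

section \<open>Powers of \<open>\<theta>\<close>\<close>

lemma theta_eq_cis: "theta = cis (pi / 6)"
  by (simp add: theta_def cis_conv_exp mult.commute)

text \<open>The order of \<open>theta\<close> is exactly 12: equal sine and cosine force the angles
  to differ by a multiple of \<open>2 * pi\<close>.\<close>

lemma theta_power_eq_iff: "theta ^ a = theta ^ b \<longleftrightarrow> a mod 12 = b mod 12"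
proof
  assume "theta ^ a = theta ^ b"
  then have "cis (real a * (pi / 6)) = cis (real b * (pi / 6))"
    by (simp only: theta_eq_cis Complex.DeMoivre)
  then have "sin (real a * (pi / 6)) = sin (real b * (pi / 6)) \<and>
      cos (real a * (pi / 6)) = cos (real b * (pi / 6))"
    by (simp only: complex_eq_iff cis.sel simp_thms)
  then obtain k :: int where "real a * (pi / 6) = real b * (pi / 6) + 2 * pi * of_int k"
    unfolding sin_cos_eq_iff by blast
  then have "pi * real a = pi * (real b + 12 * of_int k)"
    by (simp add: algebra_simps)
  then have "real a = real b + 12 * of_int k"
    by simp
  then have "real_of_int (int a) = real_of_int (int b + 12 * k)"
    by simp
  then have "int a = int b + 12 * k"
    by (simp only: of_int_eq_iff)
  then have "int (a mod 12) = int (b mod 12)"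
    by (simp add: zmod_int)
  then show "a mod 12 = b mod 12"
    by (simp only: of_nat_eq_iff)
next
  assume "a mod 12 = b mod 12"
  then show "theta ^ a = theta ^ b"
    using theta_power_mod_12[of a] theta_power_mod_12[of b] by simp
qed

lemma theta_eq: "theta = Complex (sqrt 3 / 2) (1 / 2)"
  by (simp add: theta_eq_cis cis.ctr cos_30 sin_30)

lemma theta_mult_cnj: "theta ^ k * cnj (theta ^ k) = 1"
  by (simp add: theta_eq_cis cis_cnj cis_mult flip: power_mult_distrib)

text \<open>The twelfth cyclotomic polynomial is X^4 - X^2 + 1.\<close>

lemma theta_power4: "theta ^ 4 = theta ^ 2 - 1"
  by (simp add: theta_eq complex_eq_iff power2_eq_square eval_nat_numeral algebra_simps)

lemma theta_power6: "theta ^ 6 = -1"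
proof -
  have "theta ^ 6 = theta ^ 4 * theta ^ 2"
    by (simp flip: power_add)
  also have "\<dots> = theta ^ 4 - theta ^ 2"
    by (simp add: theta_power4 algebra_simps flip: power_add)
  finally show ?thesis
    by (simp add: theta_power4)
qed

text \<open>With \<open>theta_power4\<close> and \<open>theta_power6\<close>, every power below 12
  becomes an integer combination of 1, \<open>theta\<close>, \<open>theta ^ 2\<close>,
  \<open>theta ^ 3\<close>, so that vanishing sums cancel term by term.\<close>

lemma theta_reduce:
  "theta ^ 5 = theta ^ 3 - theta"
  "theta ^ 7 = - theta"
  "theta ^ 8 = - (theta ^ 2)"
  "theta ^ 9 = - (theta ^ 3)"
  "theta ^ 10 = 1 - theta ^ 2"
  "theta ^ 11 = theta - theta ^ 3"
proof -
  have "theta ^ 5 = theta ^ 4 * theta"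
    by (simp add: eval_nat_numeral)
  then show 5: "theta ^ 5 = theta ^ 3 - theta"
    by (simp add: theta_power4) (simp add: eval_nat_numeral algebra_simps)
  have shift: "theta ^ (6 + k) = - (theta ^ k)" for k
    by (simp add: power_add theta_power6)
  show "theta ^ 7 = - theta" "theta ^ 8 = - (theta ^ 2)" "theta ^ 9 = - (theta ^ 3)"
    "theta ^ 10 = 1 - theta ^ 2" "theta ^ 11 = theta - theta ^ 3"
    using shift[of 1] shift[of 2] shift[of 3] shift[of 4] shift[of 5]
    by (simp_all add: 5 theta_power4)
qed

text \<open>Conjugation inverts \<open>theta\<close>, and 11 stands for -1 modulo 12, which keeps
  the exponents natural and in the range of \<open>theta_reduce\<close>.\<close>

lemma theta_power_mult_cnj: "theta ^ a * cnj (theta ^ b) = theta ^ ((a + 11 * b) mod 12)"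
proof -
  have "theta ^ (12 * b) = 1"
    using theta_power_mod_12[of "12 * b"] by simp
  then have "theta ^ (11 * b) * theta ^ b = 1"
    by (simp flip: power_add)
  then have "theta ^ a * cnj (theta ^ b)
      = theta ^ a * (theta ^ (11 * b) * (theta ^ b * cnj (theta ^ b)))"
    by (metis mult.assoc mult_1)
  then show ?thesis
    by (simp only: theta_mult_cnj theta_power_mod_12 power_add mult_1_right)
qed

section \<open>The exponent matrices\<close>

lemma less_6_cases:
  fixes i :: nat
  shows "i < 6 \<longleftrightarrow> i = 0 \<or> i = 1 \<or> i = 2 \<or> i = 3 \<or> i = 4 \<or> i = 5"
  by auto

lemma sum_lessThan_6:
  fixes f :: "nat \<Rightarrow> 'a::comm_monoid_add"
  shows "(\<Sum>r<6. f r) = f 0 + f 1 + f 2 + f 3 + f 4 + f 5"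
  by (simp add: eval_nat_numeral add.assoc)

lemma A_exp_carrier: "A_exp \<in> carrier_mat 6 6"
  and B_exp_carrier: "B_exp \<in> carrier_mat 6 6"
  by (auto simp: A_exp_def B_exp_def mat_of_rows_list_def)

lemma K_mat_eq: "K_mat = map_mat (\<lambda>b. theta ^ b) B_exp"
proof -
  have HT: "H_mat\<^sup>T \<in> carrier_mat 6 6"
    using A_exp_carrier by (auto simp: H_mat_def)
  have "K_mat = swaprows 4 5 (H_mat\<^sup>T)"
    unfolding K_mat_def P_mat_def by (rule swaprows_mat[symmetric, OF HT]) auto
  also have "\<dots> = map_mat (\<lambda>b. theta ^ b) B_exp"
  proof (rule eq_matI)
    fix i j assume "i < dim_row (map_mat (\<lambda>b. theta ^ b) B_exp)"
      "j < dim_col (map_mat (\<lambda>b. theta ^ b) B_exp)"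
    then have "i < 6" "j < 6"
      using B_exp_carrier by auto
    then show "swaprows 4 5 (H_mat\<^sup>T) $$ (i, j) = map_mat (\<lambda>b. theta ^ b) B_exp $$ (i, j)"
      unfolding less_6_cases
      by (elim disjE) (simp_all add: H_mat_def A_exp_def B_exp_def mat_of_rows_list_def)
  qed (use HT B_exp_carrier in auto)
  finally show ?thesis .
qed

text \<open>A finite check over the 36 pairs of columns, each a sum of six powers with explicit
  exponents.\<close>

lemma hadamard_A_exp:
  assumes "i < 6" "j < 6"
  shows "(\<Sum>r<6. theta ^ (A_exp $$ (r, i)) * cnj (theta ^ (A_exp $$ (r, j)))) = 6 * of_bool (i = j)"
  using assms unfolding theta_power_mult_cnj sum_lessThan_6 less_6_cases
  by (elim disjE) (simp_all add: A_exp_def mat_of_rows_list_def theta_reduce theta_power4 theta_power6)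

lemma hadamard_B_exp:
  assumes "i < 6" "j < 6"
  shows "(\<Sum>r<6. theta ^ (B_exp $$ (r, i)) * cnj (theta ^ (B_exp $$ (r, j)))) = 6 * of_bool (i = j)"
  using assms unfolding theta_power_mult_cnj sum_lessThan_6 less_6_cases
  by (elim disjE) (simp_all add: B_exp_def mat_of_rows_list_def theta_reduce theta_power4 theta_power6)

section \<open>The array\<close>

lemma Phi35_eq:
  assumes "i < 6" "j < 6"
  shows "Phi35 i j
    = vec 6 (\<lambda>r. theta ^ (A_exp $$ (r, i)) * theta ^ (B_exp $$ (r, j)) / of_real (sqrt 6))"
  using assms A_exp_carrier B_exp_carrier
  by (auto simp: Phi35_def schur_product_def H_mat_def K_mat_eq)

text \<open>The factors are grouped by matrix: if \<open>i = i'\<close> or \<open>j = j'\<close>,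
  one group is 1 and a Hadamard sum of the other matrix remains.\<close>

lemma Phi35_inner:
  assumes "i < 6" "j < 6" "i' < 6" "j' < 6"
  shows "Phi35 i j \<bullet>c Phi35 i' j' =
    (\<Sum>r<6. (theta ^ (A_exp $$ (r, i)) * cnj (theta ^ (A_exp $$ (r, i'))))
      * (theta ^ (B_exp $$ (r, j)) * cnj (theta ^ (B_exp $$ (r, j'))))) / 6"
proof -
  have "complex_of_real (sqrt 6) * complex_of_real (sqrt 6) = 6"
    by (simp flip: of_real_mult)
  then show ?thesis
    using assms
    by (simp add: Phi35_eq scalar_prod_def sum_divide_distrib lessThan_atLeast0 mult_ac)
qed

lemma Phi35_carrier: "i < 6 \<Longrightarrow> j < 6 \<Longrightarrow> Phi35 i j \<in> carrier_vec 6"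
  by (simp add: Phi35_eq)

lemma quantum_latin_square_Phi35: "quantum_latin_square 6 Phi35"
proof -
  have row: "Phi35 i j \<bullet>c Phi35 i j' = of_bool (j = j')" if "i < 6" "j < 6" "j' < 6" for i j j'
    \<comment> \<open>\<open>complex_cnj_power\<close> would move \<open>cnj\<close> inside the
      powers and destroy the pattern of the added rules.\<close>
    using that by (simp add: Phi35_inner theta_mult_cnj hadamard_B_exp del: complex_cnj_power)
  have col: "Phi35 i j \<bullet>c Phi35 i' j = of_bool (i = i')" if "i < 6" "i' < 6" "j < 6" for i i' j
    using that by (simp add: Phi35_inner theta_mult_cnj hadamard_A_exp del: complex_cnj_power)
  show ?thesis
    unfolding quantum_latin_square_def
    by (auto intro!: orthonormal_basisI simp: Phi35_carrier row col unit_vectors_def)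
qed

lemma Phi35_phase_equivalence_imp_eq:
  assumes "i < 6" "j < 6" "i' < 6" "j' < 6"
    and "(Phi35 i j, Phi35 i' j') \<in> phase_equivalence 6"
  shows "Phi35 i j = Phi35 i' j'"
proof -
  obtain c where c: "Phi35 i j = c \<cdot>\<^sub>v Phi35 i' j'"
    using assms by (auto simp: phase_equivalence_def)
  \<comment> \<open>Row 0 of both exponent matrices is zero, so coordinate 0 is nonzero and the same
    for all entries.\<close>
  have first: "Phi35 i j $ 0 = 1 / of_real (sqrt 6)" if "i < 6" "j < 6" for i j
    using that unfolding less_6_cases
    by (elim disjE) (simp_all add: Phi35_eq A_exp_def B_exp_def mat_of_rows_list_def)
  have "Phi35 i j $ 0 = c * Phi35 i' j' $ 0"
    using c Phi35_carrier[of i' j'] assms by auto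
  then have "c = 1"
    using assms by (simp add: first)
  then show ?thesis
    using c by simp
qed

text \<open>Lists of residues make equality of entries decidable by evaluation.\<close>

definition exponents :: "nat \<Rightarrow> nat \<Rightarrow> nat list" where
  "exponents i j = map (\<lambda>r. (A_exp $$ (r, i) + B_exp $$ (r, j)) mod 12) [0..<6]"

lemma Phi35_eq_iff_exponents:
  assumes "i < 6" "j < 6" "i' < 6" "j' < 6"
  shows "Phi35 i j = Phi35 i' j' \<longleftrightarrow> exponents i j = exponents i' j'"
  using assms
  by (simp add: Phi35_eq vec_eq_iff exponents_def theta_power_eq_iff Ball_def flip: power_add)

text \<open>Among the 36 lists the only coincidence is
  \<open>exponents 4 1 = exponents 0 4\<close>.\<close>

lemma card_exponents: "card ((\<lambda>(i, j). exponents i j) ` ({..<6} \<times> {..<6})) = 35"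
proof -
  have "(\<lambda>(i, j). exponents i j) ` ({..<6} \<times> {..<6})
      = set (map (\<lambda>(i, j). exponents i j) (List.product [0..<6] [0..<6]))"
    by (simp add: lessThan_atLeast0)
  moreover have "length (remdups (map (\<lambda>(i, j). exponents i j) (List.product [0..<6] [0..<6]))) = 35"
    by (simp add: upt_rec exponents_def A_exp_def B_exp_def mat_of_rows_list_def)
  ultimately show ?thesis
    by (simp only: List.card_set)
qed

lemma qls_cardinality_Phi35: "qls_cardinality 6 Phi35 = 35"
proof -
  let ?R = "phase_equivalence 6" and ?I = "{..<6::nat} \<times> {..<6::nat}"
  let ?X = "(\<lambda>(i, j). Phi35 i j) ` ?I"
  \<comment> \<open>Distinct entries lie in distinct classes, so counting classes amounts to
    counting vectors.\<close>
  have "inj_on (\<lambda>x. ?R `` {x}) ?X"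
  proof (rule inj_onI)
    fix x y assume "x \<in> ?X" "y \<in> ?X" and eq: "?R `` {x} = ?R `` {y}"
    then obtain i j i' j' where ij: "i < 6" "j < 6" "i' < 6" "j' < 6"
      "x = Phi35 i j" "y = Phi35 i' j'"
      by auto
    then have "y \<in> unit_vectors 6"
      using quantum_latin_square_Phi35 by (simp add: quantum_latin_square_def)
    then have "(x, y) \<in> ?R"
      using eq_equiv_class[OF eq equiv_phase_equivalence] by simp
    then show "x = y"
      using ij Phi35_phase_equivalence_imp_eq by simp
  qed
  moreover have "{Phi35 i j | i j. i < 6 \<and> j < 6} = ?X"
    by auto
  moreover have "?X // ?R = (\<lambda>x. ?R `` {x}) ` ?X"
    by (auto simp: quotient_def)
  ultimately have "qls_cardinality 6 Phi35 = card ?X"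
    by (simp only: qls_cardinality_def card_image)
  also have "\<dots> = card ((\<lambda>(i, j). exponents i j) ` ?I)"
  proof -
    \<comment> \<open>\<open>?v\<close> decodes an exponent list into its vector and is injective on
      the lists that occur.\<close>
    let ?v = "\<lambda>e. vec 6 (\<lambda>r. theta ^ (e ! r) / of_real (sqrt 6))"
    have v: "?v (exponents i j) = Phi35 i j" if "i < 6" "j < 6" for i j
      using that
      by (auto simp: Phi35_eq exponents_def theta_power_mod_12 simp flip: power_add)
    have "?X = ?v ` (\<lambda>(i, j). exponents i j) ` ?I"
      unfolding image_image by (rule image_cong) (auto simp: v)
    moreover have "inj_on ?v ((\<lambda>(i, j). exponents i j) ` ?I)"
      by (rule inj_onI) (auto simp: v Phi35_eq_iff_exponents)
    ultimately show ?thesis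
      by (simp only: card_image)
  qed
  finally show ?thesis
    by (simp only: card_exponents)
qed

theorem theorem7:
  shows "K_mat = map_mat (\<lambda>b. theta ^ b) B_exp
    \<and> quantum_latin_square 6 Phi35
    \<and> qls_cardinality 6 Phi35 = 35"
  using K_mat_eq quantum_latin_square_Phi35 qls_cardinality_Phi35 by simp

end
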